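(* Let $(\Omega,\mathcal{F},\mathbb{P})$ with $\Omega=\mathbb{R}^d$, $\mathcal{F}$ the Borel $\sigma$-field, let $g(s,w)$ be a random rational transfer function on it, and on $(\Omega^\infty,\mathcal{F}^\infty,\mathbb{P}^\infty)$ set $g_i(s,w_i)=g(s,w_i)$ for $\mathbf{w}=(w_1,w_2,\dots)$. Let $\{L_n\}$ be a sequence of real symmetric $n\times n$ graph Laplacians with $\lambda_2(L_n)\to+\infty$ as $n\to\infty$. Define $G_n(s,\mathbf{w})=\mathrm{diag}\{g_1(s,w_1),\dots,g_n(s,w_n)\}$, $$T_n(s,\mathbf{w})=(I_n+G_n(s,\mathbf{w})L_n)^{-1}G_n(s,\mathbf{w}),\quad \bar g_n(s,\mathbf{w})=\Big(\frac1n\sum_{i=1}^n g_i^{-1}(s,w_i)\Big)^{-1},\quad \hat g(s)=\Big(\int_\Omega g^{-1}(s,w)\,d\mathbb{P}(w)\Big)^{-1}.$$ Let $S\subset\mathbb{C}$ be compact and suppose: (1) $g^{-1}(s,w)$ is uniformly bounded on $S\times\Omega$; (2) $\{\bar g_n(s,\mathbf{w}),n\in\mathbb{N}_+\}$ is uniformly bounded on $S\times\Omega^\infty$; (3) there is $L>0$ with $|g^{-1}(s_1,w)-g^{-1}(s_2,w)|\le L|s_1-s_2|$ for all $w\in\Omega$, $s_1,s_2\in S$; (4) $\hat g(s)$ is uniformly continuous. Then for every $\epsilon>0$, $$\lim_{n\to\infty}\mathbb{P}^\infty\Big(\sup_{s\in S}\Big\|T_n(s,\mathbf{w})-\frac1n\hat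 g(s)\mathbf{1}\mathbf{1}^\top\Big\|\ge\epsilon\Big)=0.$$
   Context: A random rational transfer function $g(s,w)$: for each $w\in\Omega$, $g(\cdot,w)$ is a rational transfer function, with all or some coefficients being random variables on $(\Omega,\mathcal{F},\mathbb{P})$. Uniform boundedness of a family of functions on a set means a single constant bounds the absolute values of all of them at all points of the set. A graph Laplacian is real symmetric positive semidefinite with zero row sums; $\lambda_2$ is its second smallest eigenvalue. $\mathbf{1}$ is the all-ones vector, $\|\cdot\|$ the spectral norm. *)

theory Defs
  imports "HOL-Probability.Probability" "HOL-Computational_Algebra.Polynomial"
    "HOL-Library.Multiset" "Jordan_Normal_Form.Char_Poly" "Jordan_Normal_Form.Gauss_Jordan_Elimination"
begin

definition random_rational_tf :: "'w measure \<Rightarrow> (complex \<Rightarrow> 'w \<Rightarrow> complex) \<Rightarrow> bool" where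
  "random_rational_tf P g \<longleftrightarrow>
     (\<exists>(num :: 'w \<Rightarrow> real poly) (den :: 'w \<Rightarrow> real poly) N.
        (\<forall>w. den w \<noteq> 0 \<and> degree (num w) \<le> N \<and> degree (den w) \<le> N) \<and>
        (\<forall>i. (\<lambda>w. coeff (num w) i) \<in> borel_measurable P) \<and>
        (\<forall>i. (\<lambda>w. coeff (den w) i) \<in> borel_measurable P) \<and>
        (\<forall>s w. g s w = poly (map_poly complex_of_real (num w)) s
                       / poly (map_poly complex_of_real (den w)) s))"

definition graph_laplacian :: "nat \<Rightarrow> real mat \<Rightarrow> bool" where
  "graph_laplacian n A \<longleftrightarrow> A \<in> carrier_mat n n \<and> A\<^sup>T = A \<and>
     (\<forall>x \<in> carrier_vec n. x \<bullet> (A *\<^sub>v x) \<ge> 0) \<and>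
     (\<forall>i<n. (\<Sum>j<n. A $$ (i,j)) = 0)"

definition eig_mset :: "real mat \<Rightarrow> real multiset" where
  "eig_mset A = (\<Sum>x \<in> {x. poly (char_poly A) x = 0}. replicate_mset (order x (char_poly A)) x)"

definition lambda2 :: "real mat \<Rightarrow> real" where
  "lambda2 A = sorted_list_of_multiset (eig_mset A) ! 1"

definition spec_norm :: "complex mat \<Rightarrow> real" where
  "spec_norm A = Sup {sqrt (\<Sum>i<dim_row A. (cmod ((A *\<^sub>v v) $ i))\<^sup>2) | v.
       v \<in> carrier_vec (dim_col A) \<and> (\<Sum>i<dim_col A. (cmod (v $ i))\<^sup>2) = 1}"

definition mat_inv :: "complex mat \<Rightarrow> complex mat" where
  "mat_inv A = the (mat_inverse A)"

definition Tn :: "(complex \<Rightarrow> 'w \<Rightarrow> complex) \<Rightarrow> real mat \<Rightarrow> nat \<Rightarrow> complex \<Rightarrow> (nat \<Rightarrow> 'w) \<Rightarrow> complex mat" where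
  "Tn g Lap n s w = (let G = mat_diag n (\<lambda>i. g s (w i)) in
      mat_inv (1\<^sub>m n + G * map_mat complex_of_real Lap) * G)"

definition gbar :: "(complex \<Rightarrow> 'w \<Rightarrow> complex) \<Rightarrow> nat \<Rightarrow> complex \<Rightarrow> (nat \<Rightarrow> 'w) \<Rightarrow> complex" where
  "gbar g n s w = inverse ((\<Sum>i<n. inverse (g s (w i))) / of_nat n)"

definition ghat :: "'w measure \<Rightarrow> (complex \<Rightarrow> 'w \<Rightarrow> complex) \<Rightarrow> complex \<Rightarrow> complex" where
  "ghat P g s = inverse (integral\<^sup>L P (\<lambda>w. inverse (g s w)))"

text \<open>Outer probability (coincides with the probability for measurable events).\<close>
definition outer_prob :: "'a measure \<Rightarrow> 'a set \<Rightarrow> real" where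
  "outer_prob M E = Inf {measure M A | A. A \<in> sets M \<and> E \<subseteq> A}"

end

theory Submission
  imports Defs "HOL-Probability.Hoeffding"
begin

text \<open>
  Write \<open>F = diag(1 / g\<^sub>i)\<close>, so that \<open>x = T\<^sub>n v\<close> solves \<open>(F + L\<^sub>n) x = v\<close>. Splitting \<open>x\<close> along \<open>\<one>\<close>
  and its orthogonal complement, on which \<open>L\<^sub>n \<ge> \<lambda>\<^sub>2(L\<^sub>n)\<close>, gives
  \<open>\<parallel>T\<^sub>n - (gbar\<^sub>n / n) \<one> \<one>\<^sup>T\<parallel> = O(1 / \<lambda>\<^sub>2(L\<^sub>n))\<close>, uniformly in \<open>s\<close> and in the sample. It remains to
  show that the sample mean of \<open>1 / g\<close> is uniformly close to its expectation on \<open>S\<close> with high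
  probability. Hoeffding's inequality does this on a finite net of \<open>S\<close>, and the Lipschitz
  condition extends it to \<open>S\<close>. On that event the lower bound on the sample mean passes to the
  expectation, so inversion is Lipschitz there and \<open>gbar\<^sub>n\<close> is close to \<open>ghat\<close>.
\<close>

section \<open>The spectral gap of a graph Laplacian\<close>

text \<open>The unit vectors orthogonal to the all-ones vector form a compact set, so the quadratic
  form attains its minimum there; homogeneity of degree 2 extends the bound to every vector of zero
  sum.\<close>

lemma rayleigh_minimizer:
  fixes a :: "nat \<Rightarrow> nat \<Rightarrow> real"
  assumes n: "n \<ge> 2"
  obtains x \<mu> where "(\<Sum>i<n. x i) = 0" "(\<Sum>i<n. (x i)\<^sup>2) = 1"
    "(\<Sum>i<n. x i * (\<Sum>j<n. a i j * x j)) = \<mu>"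
    "\<And>y. (\<Sum>i<n. y i) = 0 \<Longrightarrow> \<mu> * (\<Sum>i<n. (y i)\<^sup>2) \<le> (\<Sum>i<n. y i * (\<Sum>j<n. a i j * y j))"
proof -
  \<comment> \<open>Vectors are functions on all of \<open>nat\<close>; pinning the coordinates from
    \<open>n\<close> on to 0 makes \<open>K\<close> a product of compact sets, compact in the
    product topology by Tychonoff.\<close>
  define K where "K = (PiE UNIV (\<lambda>i. if i < n then {-1..1} else {0}) :: (nat \<Rightarrow> real) set)"
  define Q where "Q = (\<lambda>x::nat \<Rightarrow> real. \<Sum>i<n. x i * (\<Sum>j<n. a i j * x j))"
  define T where "T = {x::nat\<Rightarrow>real. (\<Sum>i<n. x i) = 0} \<inter> {x. (\<Sum>i<n. (x i)\<^sup>2) = 1}"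
  have cK: "compact K"
  proof -
    have "compactin (product_topology (\<lambda>i. euclidean) UNIV) K"
      unfolding K_def compactin_PiE by auto
    then show ?thesis unfolding euclidean_product_topology by simp
  qed
  have coord: "continuous_on A (\<lambda>x::nat\<Rightarrow>real. x i)" for i A
    by (rule continuous_on_subset[OF continuous_on_product_coordinates]) auto
  have cT: "closed T" unfolding T_def
    by (intro closed_Int closed_Collect_eq continuous_intros coord)
  have cKT: "compact (K \<inter> T)" using cK cT by (rule compact_Int_closed)
  \<comment> \<open>The normalised difference of the first two unit vectors shows that the
    constraint set is nonempty; it fits because \<open>n \<ge> 2\<close>.\<close>
  define e where "e = (\<lambda>i::nat. if i = 0 then 1 / sqrt 2 else if i = 1 then - 1 / sqrt 2 else (0::real))"
  have split: "(\<Sum>i<n. h i) = h 0 + h 1 + (\<Sum>i=2..<n. h i)" for h :: "nat \<Rightarrow> real"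
    using n by (simp add: lessThan_atLeast0 sum.atLeast_Suc_lessThan numeral_2_eq_2)
  have "(\<Sum>i=2..<n. e i) = 0" "(\<Sum>i=2..<n. (e i)\<^sup>2) = 0"
    by (rule sum.neutral; simp add: e_def)+
  then have "e \<in> T" unfolding T_def by (simp add: split[of e] split[of "\<lambda>i. (e i)\<^sup>2"]) (simp add: e_def power_divide)
  moreover have "-1 \<le> 1 / sqrt (2::real)" by (rule order_trans[of _ 0]) auto
  then have "e i \<in> (if i < n then {-1..1} else {0})" for i using n by (simp add: e_def)
  then have "e \<in> K" unfolding K_def by blast
  ultimately have ne: "K \<inter> T \<noteq> {}" by auto
  have "continuous_on (K \<inter> T) Q" unfolding Q_def
    by (intro continuous_intros coord)
  from continuous_attains_inf[OF cKT ne this] obtain x where x: "x \<in> K \<inter> T" 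
    and min: "\<And>y. y \<in> K \<inter> T \<Longrightarrow> Q x \<le> Q y" by auto
  show ?thesis
  proof
    show "(\<Sum>i<n. x i) = 0" "(\<Sum>i<n. (x i)\<^sup>2) = 1" using x by (auto simp: T_def)
    show "(\<Sum>i<n. x i * (\<Sum>j<n. a i j * x j)) = Q x" by (simp add: Q_def)
    fix y :: "nat \<Rightarrow> real" assume y0: "(\<Sum>i<n. y i) = 0"
    define r where "r = (\<Sum>i<n. (y i)\<^sup>2)"
    have r0: "r \<ge> 0" unfolding r_def by (simp add: sum_nonneg)
    show "Q x * (\<Sum>i<n. (y i)\<^sup>2) \<le> (\<Sum>i<n. y i * (\<Sum>j<n. a i j * y j))"
    proof (cases "r = 0")
      case True
      then have "\<forall>i<n. y i = 0" unfolding r_def by (subst (asm) sum_nonneg_eq_0_iff) auto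
      then show ?thesis by simp
    next
      case False
      with r0 have rp: "r > 0" by simp
      \<comment> \<open>Normalising and cutting off at \<open>n\<close> moves \<open>y\<close> into
        the constraint set, at the price of a factor \<open>r\<close> in \<open>Q\<close>.\<close>
      define z where "z = (\<lambda>i. if i < n then y i / sqrt r else 0)"
      have z2: "(\<Sum>i<n. (z i)\<^sup>2) = 1"
        using rp by (simp add: z_def power_divide sum_divide_distrib[symmetric] r_def[symmetric])
      have "(\<Sum>i<n. z i) = 0" using y0 by (simp add: z_def sum_divide_distrib[symmetric])
      then have zT: "z \<in> T" using z2 by (simp add: T_def)
      have "(z i)\<^sup>2 \<le> 1" if "i < n" for i
        unfolding z2[symmetric] using that by (intro member_le_sum) auto
      then have "\<bar>z i\<bar> \<le> 1" if "i < n" for i using that by (simp add: abs_square_le_1)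
      then have "z i \<in> (if i < n then {-1..1} else {0})" for i by (cases "i < n") (force simp: abs_le_iff, simp add: z_def)
      then have "z \<in> K" unfolding K_def by blast
      with zT have "Q x \<le> Q z" using min by auto
      also have "Q z = (\<Sum>i<n. y i * (\<Sum>j<n. a i j * y j) / r)" unfolding Q_def
      proof (intro sum.cong refl)
        fix i assume "i \<in> {..<n}"
        moreover have "(\<Sum>j<n. a i j * z j) = (\<Sum>j<n. a i j * y j) / sqrt r"
          by (simp add: z_def sum_divide_distrib)
        ultimately show "z i * (\<Sum>j<n. a i j * z j) = y i * (\<Sum>j<n. a i j * y j) / r"
          using rp by (simp add: z_def)
      qed
      also have "\<dots> = Q y / r" by (simp add: Q_def sum_divide_distrib)
      finally show ?thesis using rp by (simp add: Q_def r_def field_simps)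
    qed
  qed
qed

text \<open>A Lagrange multiplier argument without calculus: the residual \<open>z\<close> of the
  eigenvalue equation is itself orthogonal to the all-ones vector, hence an admissible direction,
  and minimality along \<open>x + t z\<close> forces its norm to be 0.\<close>

lemma constrained_minimizer_eigenvector:
  fixes a :: "nat \<Rightarrow> nat \<Rightarrow> real"
  assumes sym: "\<And>i j. i < n \<Longrightarrow> j < n \<Longrightarrow> a i j = a j i"
    and row: "\<And>i. i < n \<Longrightarrow> (\<Sum>j<n. a i j) = 0"
    and x0: "(\<Sum>i<n. x i) = 0" and x1: "(\<Sum>i<n. (x i)\<^sup>2) = 1"
    and xm: "(\<Sum>i<n. x i * (\<Sum>j<n. a i j * x j)) = \<mu>"
    and min: "\<And>y. (\<Sum>i<n. y i) = 0 \<Longrightarrow> \<mu> * (\<Sum>i<n. (y i)\<^sup>2) \<le> (\<Sum>i<n. y i * (\<Sum>j<n. a i j * y j))"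
    and i: "i < n"
  shows "(\<Sum>j<n. a i j * x j) = \<mu> * x i"
proof -
  define A where "A = (\<lambda>x i. \<Sum>j<n. a i j * x j)"
  define z where "z = (\<lambda>i. A x i - \<mu> * x i)"
  define B where "B = (\<lambda>u v. \<Sum>i<n. u i * A v i - \<mu> * (u i * v i))"
  have A_sym: "(\<Sum>i<n. u i * A v i) = (\<Sum>i<n. v i * A u i)" for u v
  proof -
    have "(\<Sum>i<n. u i * A v i) = (\<Sum>i<n. \<Sum>j<n. u i * a i j * v j)"
      by (simp add: A_def sum_distrib_left mult.assoc)
    also have "\<dots> = (\<Sum>j<n. \<Sum>i<n. u i * a i j * v j)" by (rule sum.swap)
    also have "\<dots> = (\<Sum>i<n. v i * A u i)"
      by (simp add: A_def sum_distrib_left) (intro sum.cong refl, simp add: sym)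
    finally show ?thesis .
  qed
  \<comment> \<open>The factor 1 exposes a pairing with the all-ones vector; symmetry moves the
    matrix onto that vector, which it kills.\<close>
  have "(\<Sum>i<n. A x i) = (\<Sum>i<n. 1 * A x i)" by simp
  also have "\<dots> = (\<Sum>i<n. x i * A (\<lambda>_. 1) i)" by (rule A_sym)
  also have "\<dots> = 0" by (simp add: A_def row)
  finally have z0: "(\<Sum>i<n. z i) = 0"
    using x0 by (simp add: z_def sum_subtractf sum_distrib_left[symmetric])
  have Bxx: "B x x = 0" using xm x1 by (simp add: B_def A_def sum_subtractf sum_distrib_left[symmetric] power2_eq_square)
  have Bs: "B u v = B v u" for u v using A_sym[of u v]
    by (simp add: B_def sum_subtractf sum_distrib_left[symmetric] mult.commute)
  have Bpos: "B y y \<ge> 0" if "(\<Sum>i<n. y i) = 0" for y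
    using min[OF that] by (simp add: B_def A_def sum_subtractf sum_distrib_left[symmetric] power2_eq_square)
  have Bzx: "B z x = (\<Sum>i<n. (z i)\<^sup>2)"
    by (simp add: B_def z_def power2_eq_square algebra_simps)
  have expand: "B (\<lambda>i. x i + t * z i) (\<lambda>i. x i + t * z i) = B x x + t * (B x z + B z x) + t\<^sup>2 * B z z" for t
  proof -
    have "A (\<lambda>i. x i + t * z i) i = A x i + t * A z i" for i
      by (simp add: A_def algebra_simps sum.distrib sum_distrib_left)
    then show ?thesis
      by (simp add: B_def sum_distrib_left sum.distrib[symmetric] power2_eq_square)
        (intro sum.cong refl, simp add: algebra_simps)
  qed
  \<comment> \<open>By \<open>Bzx\<close> this is the squared norm of the residual. Along
    \<open>x + t z\<close> the nonnegative form has no constant term, so its linear coefficient must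
    vanish.\<close>
  define q where "q = B z x"
  have quad: "0 \<le> 2 * t * q + t\<^sup>2 * B z z" for t
  proof -
    have "(\<Sum>i<n. x i + t * z i) = 0" using x0 z0 by (simp add: sum.distrib sum_distrib_left[symmetric])
    from Bpos[OF this] show ?thesis unfolding expand Bxx Bs[of x z] q_def by simp
  qed
  have q0: "q \<ge> 0" unfolding q_def Bzx by (simp add: sum_nonneg)
  have "B z z \<ge> 0" using Bpos[OF z0] .
  have "q = 0"
  proof (rule ccontr)
    assume "q \<noteq> 0" with q0 have qp: "q > 0" by simp
    \<comment> \<open>Close to the minimiser of the quadratic in \<open>t\<close>; the added 1 keeps
      the denominator positive when \<open>B z z = 0\<close>.\<close>
    define t where "t = - q / (B z z + 1)"
    have bp: "B z z + 1 > 0" using \<open>B z z \<ge> 0\<close> by simp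
    have id: "2 * (- q / c) * q + (- q / c)\<^sup>2 * b = (q\<^sup>2 / c) * (b / c - 2)" for b c
      by (simp add: power2_eq_square algebra_simps)
    have "2 * t * q + t\<^sup>2 * B z z = (q\<^sup>2 / (B z z + 1)) * (B z z / (B z z + 1) - 2)"
      unfolding t_def by (rule id)
    also have "\<dots> < 0"
      using bp qp by (intro mult_pos_neg) (auto simp: field_simps)
    finally show False using quad[of t] by simp
  qed
  then have "\<forall>i<n. z i = 0" unfolding q_def Bzx by (subst (asm) sum_nonneg_eq_0_iff) auto
  then show ?thesis using i by (simp add: z_def A_def)
qed

text \<open>If the second entry exceeded \<open>b\<close>, sortedness would leave at most one entry
  below or equal to \<open>b\<close>, whereas \<open>a\<close> and \<open>b\<close> already count as
  two.\<close>

lemma sorted_nth_1_le: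
  fixes a b :: "'a::linorder"
  assumes "{#a, b#} \<subseteq># M" "a \<le> b"
  shows "sorted_list_of_multiset M ! 1 \<le> b"
proof -
  define xs where "xs = sorted_list_of_multiset M"
  have ms: "mset xs = M" and so: "sorted xs" by (simp_all add: xs_def)
  from assms(1) obtain N where M: "M = {#a, b#} + N" using subset_mset.le_iff_add by metis
  then have "size xs \<ge> 2" using arg_cong[OF ms, of size] by simp
  then obtain u v ys where xs: "xs = u # v # ys"
    by (cases xs; cases "tl xs") auto
  have "v \<le> b"
  proof (rule ccontr)
    assume "\<not> v \<le> b"
    then have "\<forall>w\<in>set (v # ys). b < w" using so xs by auto
    then have "filter_mset (\<lambda>x. x \<le> b) (mset (v # ys)) = {#}"
      unfolding set_mset_eq_empty_iff[symmetric] by (auto simp: not_le)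
    then have "size (filter_mset (\<lambda>x. x \<le> b) (mset xs)) \<le> 1"
      unfolding xs by simp
    then have "size (filter_mset (\<lambda>x. x \<le> b) M) \<le> 1" unfolding ms .
    then show False unfolding M using assms(2) by simp
  qed
  then show ?thesis unfolding xs_def[symmetric] xs by simp
qed

section \<open>Multiplicities of eigenvalues\<close>

lemma count_eig_mset:
  assumes "A \<in> carrier_mat n n"
  shows "count (eig_mset A) x = order x (char_poly A)"
proof -
  have nz: "char_poly A \<noteq> 0" using degree_monic_char_poly[OF assms] by auto
  have fin: "finite {x. poly (char_poly A) x = 0}" by (rule poly_roots_finite[OF nz])
  have "count (eig_mset A) x = (\<Sum>y \<in> {x. poly (char_poly A) x = 0}. if y = x then order x (char_poly A) else 0)"
    unfolding eig_mset_def count_sum by (intro sum.cong refl) simp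
  also have "\<dots> = (if x \<in> {x. poly (char_poly A) x = 0} then order x (char_poly A) else 0)"
    by (rule sum.delta[OF fin])
  also have "\<dots> = order x (char_poly A)" using order_root[of "char_poly A" x] by auto
  finally show ?thesis .
qed

lemma eigenvalueI:
  fixes A :: "real mat"
  assumes A: "A \<in> carrier_mat n n" and i: "i < n" "x i \<noteq> 0"
    and Ax: "\<And>i. i < n \<Longrightarrow> (\<Sum>j<n. A $$ (i,j) * x j) = \<mu> * x i"
  shows "poly (char_poly A) \<mu> = 0"
proof -
  have "eigenvector A (vec n x) \<mu>" unfolding eigenvector_def
  proof (intro conjI)
    show "vec n x \<in> carrier_vec (dim_row A)" using A by auto
    show "vec n x \<noteq> 0\<^sub>v (dim_row A)"
    proof
      assume "vec n x = 0\<^sub>v (dim_row A)"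
      then have "vec n x $ i = 0\<^sub>v (dim_row A) $ i" by simp
      then show False using i A by simp
    qed
    show "A *\<^sub>v vec n x = \<mu> \<cdot>\<^sub>v vec n x"
      using A Ax by (intro eq_vecI) (auto simp: scalar_prod_def lessThan_atLeast0)
  qed
  then show ?thesis using eigenvalue_root_char_poly[OF A] by (auto simp: eigenvalue_def)
qed

text \<open>A combination of two kernel vectors vanishes in any prescribed coordinate, so all
  principal minors of size \<open>n - 1\<close> vanish, and so does the derivative of the characteristic
  polynomial at 0.\<close>

lemma order_0_char_poly_ge_2:
  fixes A :: "real mat"
  assumes A: "A \<in> carrier_mat n n"
    and row: "\<And>i. i < n \<Longrightarrow> (\<Sum>j<n. A $$ (i,j)) = 0"
    and Ax: "\<And>i. i < n \<Longrightarrow> (\<Sum>j<n. A $$ (i,j) * x j) = 0"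
    and ij: "k < n" "l < n" "x k \<noteq> x l"
  shows "order 0 (char_poly A) \<ge> 2"
proof -
  have nz: "char_poly A \<noteq> 0" using degree_monic_char_poly[OF A] by auto
  have r0: "poly (char_poly A) 0 = 0"
    by (rule eigenvalueI[OF A ij(1), of "\<lambda>_. 1"]) (auto simp: row)
  have minor: "poly (char_poly (mat_delete A i i)) 0 = 0" if i: "i < n" for i
  proof -
    define z where "z = (\<lambda>j. x j - x i)"
    define z' where "z' = (\<lambda>j. z (insert_index i j))"
    from i obtain m where n: "n = Suc m" by (cases n) auto
    have zi: "z i = 0" by (simp add: z_def)
    have Az: "(\<Sum>j<n. A $$ (r,j) * z j) = 0" if "r < n" for r
      using Ax[OF that] row[OF that] by (simp add: z_def algebra_simps sum_subtractf sum_distrib_left[symmetric])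
    obtain p where p: "p < n" "x p \<noteq> x i" using ij by metis
    then have "p \<in> insert_index i ` {..<m}"
      using insert_index_image[of i m] i n by (auto simp: lessThan_atLeast0)
    then obtain p' where p': "p' < m" "insert_index i p' = p" by auto
    show ?thesis
    proof (rule eigenvalueI[where n = m and x = z' and i = p'])
      show "mat_delete A i i \<in> carrier_mat m m" using A n mat_delete_carrier[of A n n i i] by simp
      show "p' < m" by fact
      show "z' p' \<noteq> 0" using p p' by (simp add: z'_def z_def)
      fix r assume r: "r < m"
      have "(\<Sum>j<m. mat_delete A i i $$ (r,j) * z' j) = (\<Sum>j<m. A $$ (insert_index i r, insert_index i j) * z (insert_index i j))"
        using A n i r by (intro sum.cong) (auto simp: z'_def mat_delete_index[symmetric])
      also have "\<dots> = (\<Sum>j\<in>insert_index i ` {..<m}. A $$ (insert_index i r, j) * z j)"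
        by (subst sum.reindex) (auto intro: insert_index_inj_on)
      also have "insert_index i ` {..<m} = {..<n} - {i}"
        using insert_index_image[of i m] i n by (simp add: lessThan_atLeast0)
      also have "(\<Sum>j\<in>{..<n} - {i}. A $$ (insert_index i r, j) * z j) = (\<Sum>j<n. A $$ (insert_index i r, j) * z j)"
        using i zi by (intro sum.mono_neutral_left) auto
      also have "\<dots> = 0" using r n by (intro Az) (auto simp: insert_index_def)
      finally show "(\<Sum>j<m. mat_delete A i i $$ (r,j) * z' j) = 0 * z' r" by simp
    qed
  qed
  \<comment> \<open>The derivative of the characteristic polynomial is the sum of the characteristic
    polynomials of the submatrices obtained by deleting row and column \<open>i\<close>.\<close>
  have d0: "poly (pderiv (char_poly A)) 0 = 0"
    unfolding pderiv_char_poly[OF A] by (simp add: poly_sum minor)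
  have dnz: "pderiv (char_poly A) \<noteq> 0"
    using degree_monic_char_poly[OF A] ij(1) by (simp add: pderiv_eq_0_iff)
  have "order 0 (char_poly A) = Suc (order 0 (pderiv (char_poly A)))"
    using r0 nz by (intro order_pderiv) (auto simp: order_root)
  moreover have "order 0 (pderiv (char_poly A)) \<ge> 1"
    using d0 dnz order_root[of "pderiv (char_poly A)" 0] by (simp add: Suc_le_eq)
  ultimately show ?thesis by simp
qed

text \<open>The constrained minimum \<open>\<mu>\<close> is a nonnegative eigenvalue with an
  eigenvector orthogonal to the all-ones vector. Hence 0 and \<open>\<mu>\<close> are two entries of
  the spectrum, which puts the second smallest one at most at \<open>\<mu>\<close>.\<close>

lemma graph_laplacian_poincare:
  assumes lap: "graph_laplacian n A" and n: "n \<ge> 2" and y: "(\<Sum>i<n. y i) = 0"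
  shows "lambda2 A * (\<Sum>i<n. (y i)\<^sup>2) \<le> (\<Sum>i<n. y i * (\<Sum>j<n. A $$ (i,j) * y j))"
proof -
  have A: "A \<in> carrier_mat n n" and T: "A\<^sup>T = A"
    and psd: "\<And>x. x \<in> carrier_vec n \<Longrightarrow> x \<bullet> (A *\<^sub>v x) \<ge> 0"
    and row: "\<And>i. i < n \<Longrightarrow> (\<Sum>j<n. A $$ (i,j)) = 0"
    using lap by (auto simp: graph_laplacian_def)
  have sym: "A $$ (i,j) = A $$ (j,i)" if "i < n" "j < n" for i j
    using that A arg_cong[OF T, of "\<lambda>M. M $$ (i,j)"] by simp
  obtain x \<mu> where x: "(\<Sum>i<n. x i) = 0" "(\<Sum>i<n. (x i)\<^sup>2) = 1"
    "(\<Sum>i<n. x i * (\<Sum>j<n. A $$ (i,j) * x j)) = \<mu>"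
    and min: "\<And>y. (\<Sum>i<n. y i) = 0 \<Longrightarrow> \<mu> * (\<Sum>i<n. (y i)\<^sup>2) \<le> (\<Sum>i<n. y i * (\<Sum>j<n. A $$ (i,j) * y j))"
    by (rule rayleigh_minimizer[OF n, where a = "\<lambda>i j. A $$ (i,j)"]) (rule that)
  have ev: "(\<Sum>j<n. A $$ (i,j) * x j) = \<mu> * x i" if "i < n" for i
    by (rule constrained_minimizer_eigenvector[of n "\<lambda>i j. A $$ (i,j)", OF sym row x min that])
  obtain k where k: "k < n" "x k \<noteq> 0"
  proof -
    have "\<exists>k<n. x k \<noteq> 0"
    proof (rule ccontr)
      assume "\<not> ?thesis"
      then have "(\<Sum>i<n. (x i)\<^sup>2) = 0" by (intro sum.neutral) auto
      with x(2) show False by simp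
    qed
    then show ?thesis using that by auto
  qed
  have mu: "\<mu> \<ge> 0"
  proof -
    have "vec n x \<bullet> (A *\<^sub>v vec n x) = (\<Sum>i<n. x i * (\<Sum>j<n. A $$ (i,j) * x j))"
      using A by (simp add: scalar_prod_def lessThan_atLeast0)
    with psd[of "vec n x"] x(3) show ?thesis by simp
  qed
  have nz: "char_poly A \<noteq> 0" using degree_monic_char_poly[OF A] by auto
  have root_mu: "poly (char_poly A) \<mu> = 0" by (rule eigenvalueI[OF A k ev])
  have root_0: "poly (char_poly A) 0 = 0"
    by (rule eigenvalueI[OF A k(1), of "\<lambda>_. 1"]) (auto simp: row)
  \<comment> \<open>For \<open>\<mu> = 0\<close> the root 0 must be counted twice; \<open>x\<close>
    has zero sum and a nonzero entry, so it is a nonconstant kernel vector, as the multiplicity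
    lemma demands.\<close>
  have "{#0, \<mu>#} \<subseteq># eig_mset A"
  proof (cases "\<mu> = 0")
    case True
    obtain l where l: "l < n" "x k \<noteq> x l"
    proof -
      have "\<exists>l<n. x k \<noteq> x l"
      proof (rule ccontr)
        assume "\<not> ?thesis"
        then have "(\<Sum>i<n. x i) = (\<Sum>i<n. x k)" by (intro sum.cong) auto
        with x(1) k n show False by simp
      qed
      then show ?thesis using that by auto
    qed
    have "(\<Sum>j<n. A $$ (i,j) * x j) = 0" if "i < n" for i using ev[OF that] True by simp
    from order_0_char_poly_ge_2[OF A row this k(1) l]
    have "count (eig_mset A) 0 \<ge> 2" by (simp add: count_eig_mset[OF A])
    then have "count {#0, \<mu>#} r \<le> count (eig_mset A) r" for r using True by (cases "r = 0") auto
    then show ?thesis by (rule mset_subset_eqI)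
  next
    case False
    have "order 0 (char_poly A) \<noteq> 0" "order \<mu> (char_poly A) \<noteq> 0"
      using root_0 root_mu nz by (auto simp: order_root)
    then have "count (eig_mset A) 0 \<ge> 1" "count (eig_mset A) \<mu> \<ge> 1" by (simp_all add: count_eig_mset[OF A])
    then have "count {#0, \<mu>#} r \<le> count (eig_mset A) r" for r using False by auto
    then show ?thesis by (rule mset_subset_eqI)
  qed
  from sorted_nth_1_le[OF this mu] have "lambda2 A \<le> \<mu>" by (simp add: lambda2_def)
  then have "lambda2 A * (\<Sum>i<n. (y i)\<^sup>2) \<le> \<mu> * (\<Sum>i<n. (y i)\<^sup>2)"
    by (intro mult_right_mono) (auto simp: sum_nonneg)
  with min[OF y] show ?thesis by linarith
qed

section \<open>The network system\<close>

lemma L2_set_cmod_cauchy_schwarz: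
  "cmod (\<Sum>i\<in>I. cnj (x i) * y i) \<le> L2_set (\<lambda>i. cmod (x i)) I * L2_set (\<lambda>i. cmod (y i)) I"
proof -
  have "cmod (\<Sum>i\<in>I. cnj (x i) * y i) \<le> (\<Sum>i\<in>I. \<bar>cmod (x i)\<bar> * \<bar>cmod (y i)\<bar>)"
    by (rule order_trans[OF norm_sum]) (simp add: norm_mult)
  also have "\<dots> \<le> L2_set (\<lambda>i. cmod (x i)) I * L2_set (\<lambda>i. cmod (y i)) I"
    by (rule L2_set_mult_ineq)
  finally show ?thesis .
qed

lemma L2_set_cmod_triangle:
  "L2_set (\<lambda>i. cmod (x i + y i)) I \<le> L2_set (\<lambda>i. cmod (x i)) I + L2_set (\<lambda>i. cmod (y i)) I"
  by (rule order_trans[OF L2_set_mono L2_set_triangle_ineq]) (auto intro: norm_triangle_ineq)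

lemma L2_set_cmod_mult_le:
  assumes "\<And>i. i \<in> I \<Longrightarrow> cmod (f i) \<le> C" "C \<ge> 0"
  shows "L2_set (\<lambda>i. cmod (f i * x i)) I \<le> C * L2_set (\<lambda>i. cmod (x i)) I"
  unfolding L2_set_right_distrib[OF assms(2)]
  by (rule L2_set_mono) (auto simp: norm_mult intro: mult_right_mono assms(1))

lemma L2_set_const: "L2_set (\<lambda>i. c) {..<n} = sqrt (real n) * \<bar>c\<bar>"
  by (simp add: L2_set_def real_sqrt_mult)

lemma L2_set_cmod_power2: "(L2_set (\<lambda>i. cmod (x i)) I)\<^sup>2 = (\<Sum>i\<in>I. (cmod (x i))\<^sup>2)"
  by (simp add: L2_set_def sum_nonneg)

text \<open>Cauchy-Schwarz against the all-ones vector: the rank-one matrix with all entries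
  \<open>c / n\<close> has operator norm at most \<open>cmod c\<close>.\<close>

lemma L2_set_cmod_mean_le:
  assumes "n > 0"
  shows "L2_set (\<lambda>_. cmod (c / of_nat n * (\<Sum>i<n. u i))) {..<n} \<le> cmod c * L2_set (\<lambda>i. cmod (u i)) {..<n}"
proof -
  have "cmod (\<Sum>i<n. u i) \<le> sqrt n * L2_set (\<lambda>i. cmod (u i)) {..<n}"
    using L2_set_cmod_cauchy_schwarz[of "\<lambda>_. 1" u "{..<n}"] L2_set_const[of 1 n] by simp
  then have "sqrt n * cmod (c / of_nat n) * cmod (\<Sum>i<n. u i)
      \<le> sqrt n * cmod (c / of_nat n) * (sqrt n * L2_set (\<lambda>i. cmod (u i)) {..<n})"
    by (intro mult_left_mono) auto
  also have "\<dots> = (sqrt n * sqrt n) * cmod (c / of_nat n) * L2_set (\<lambda>i. cmod (u i)) {..<n}"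
    by (simp only: mult_ac)
  also have "\<dots> = cmod c * L2_set (\<lambda>i. cmod (u i)) {..<n}"
    using assms by (simp add: norm_divide)
  finally show ?thesis unfolding L2_set_const abs_norm_cancel unfolding norm_mult[of "c / of_nat n"] by (simp only: mult.assoc)
qed

text \<open>The matrix is real, so the real part of the Hermitian form splits into the real forms at
  \<open>Re y\<close> and \<open>Im y\<close>.\<close>

lemma complex_poincare:
  assumes lap: "graph_laplacian n A" and n: "n \<ge> 2" and y: "(\<Sum>i<n. y i) = (0::complex)"
  shows "lambda2 A * (\<Sum>i<n. (cmod (y i))\<^sup>2)
    \<le> Re (\<Sum>i<n. cnj (y i) * (\<Sum>j<n. of_real (A $$ (i,j)) * y j))"
proof -
  have y': "(\<Sum>i<n. Re (y i)) = 0" "(\<Sum>i<n. Im (y i)) = 0"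
    using arg_cong[OF y, of Re] arg_cong[OF y, of Im] by (simp_all)
  have "lambda2 A * (\<Sum>i<n. (cmod (y i))\<^sup>2) =
      lambda2 A * (\<Sum>i<n. (Re (y i))\<^sup>2) + lambda2 A * (\<Sum>i<n. (Im (y i))\<^sup>2)"
    by (simp add: cmod_power2 sum.distrib algebra_simps)
  also have "\<dots> \<le> (\<Sum>i<n. Re (y i) * (\<Sum>j<n. A $$ (i,j) * Re (y j)))
      + (\<Sum>i<n. Im (y i) * (\<Sum>j<n. A $$ (i,j) * Im (y j)))"
    by (intro add_mono graph_laplacian_poincare[OF lap n] y')
  also have "\<dots> = Re (\<Sum>i<n. cnj (y i) * (\<Sum>j<n. of_real (A $$ (i,j)) * y j))"
    by (simp add: sum.distrib)
  finally show ?thesis .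
qed

text \<open>Symmetry turns zero row sums into zero column sums. The first part removes the coupling
  when all equations are added, the second when a constant is subtracted from the state.\<close>

lemma laplacian_sum_eq_0:
  assumes lap: "graph_laplacian n A"
  shows "(\<Sum>i<n. \<Sum>j<n. of_real (A $$ (i,j)) * x j) = (0::complex)"
    and "i < n \<Longrightarrow> (\<Sum>j<n. of_real (A $$ (i,j)) * (c::complex)) = 0"
proof -
  have A: "A \<in> carrier_mat n n" and T: "A\<^sup>T = A"
    and row: "\<And>i. i < n \<Longrightarrow> (\<Sum>j<n. A $$ (i,j)) = 0"
    using lap by (auto simp: graph_laplacian_def)
  have sym: "A $$ (i,j) = A $$ (j,i)" if "i < n" "j < n" for i j
    using that A arg_cong[OF T, of "\<lambda>M. M $$ (i,j)"] by simp
  show rowc: "(\<Sum>j<n. of_real (A $$ (i,j)) * (c::complex)) = 0" if "i < n" for i c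
    using row[OF that] by (simp add: sum_distrib_right[symmetric] of_real_sum[symmetric])
  have "(\<Sum>i<n. \<Sum>j<n. of_real (A $$ (i,j)) * x j) = (\<Sum>j<n. \<Sum>i<n. of_real (A $$ (i,j)) * x j)"
    by (rule sum.swap)
  also have "\<dots> = (\<Sum>j<n. \<Sum>i<n. of_real (A $$ (j,i)) * x j)"
    by (intro sum.cong refl) (simp add: sym)
  also have "\<dots> = 0" by (simp add: rowc)
  finally show "(\<Sum>i<n. \<Sum>j<n. of_real (A $$ (i,j)) * x j) = (0::complex)" .
qed

text \<open>Split \<open>x = \<alpha> \<one> + y\<close> with \<open>y \<bottom> \<one>\<close>. Pairing the equation with \<open>y\<close> shows that \<open>y\<close>
  is of order \<open>1 / lambda2 A\<close>; pairing it with \<open>\<one>\<close> determines \<open>\<alpha>\<close> up to a multiple of \<open>y\<close>.\<close>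

lemma laplacian_system_estimate:
  fixes f x b :: "nat \<Rightarrow> complex"
  assumes lap: "graph_laplacian n A" and n: "n \<ge> 2"
    and C: "C \<ge> 0" "\<And>i. i < n \<Longrightarrow> cmod (f i) \<le> C"
    and m: "m = (\<Sum>i<n. f i) / of_nat n" "m \<noteq> 0" "cmod (inverse m) \<le> D"
    and eq: "\<And>i. i < n \<Longrightarrow> f i * x i + (\<Sum>j<n. of_real (A $$ (i,j)) * x j) = b i"
    and lam: "lambda2 A > 0" "2 * C * (1 + C * D) \<le> lambda2 A"
  defines "N \<equiv> \<lambda>x. L2_set (\<lambda>i. cmod (x i)) {..<n}"
  shows "N x \<le> 2 * (D + (1 + C * D) / lambda2 A) * N b"
    and "N (\<lambda>i. x i - inverse m / of_nat n * (\<Sum>i<n. b i))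
      \<le> (1 + C * D) * (N b + C * N x) / lambda2 A"
proof -
  have D: "D \<ge> 0" using m(3) norm_ge_zero order_trans by blast
  define \<kappa> where "\<kappa> = lambda2 A"
  have lpos: "\<kappa> > 0" using lam(1) by (simp add: \<kappa>_def)
  define \<alpha> where "\<alpha> = (\<Sum>i<n. x i) / of_nat n"
  define y where "y = (\<lambda>i. x i - \<alpha>)"
  define Lx where "Lx = (\<lambda>i. \<Sum>j<n. of_real (A $$ (i,j)) * x j)"
  have x: "x i = \<alpha> + y i" for i by (simp add: y_def)
  have y0: "(\<Sum>i<n. y i) = 0" using n by (simp add: y_def sum_subtractf \<alpha>_def)
  have Nnn: "N u \<ge> 0" for u by (simp add: N_def L2_set_nonneg)
  have Ly: "(\<Sum>j<n. of_real (A $$ (i,j)) * y j) = Lx i" if "i < n" for i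
    using laplacian_sum_eq_0(2)[OF lap that, of \<alpha>]
    by (simp add: Lx_def y_def algebra_simps sum_subtractf)
  have "\<kappa> * (N y)\<^sup>2 \<le> Re (\<Sum>i<n. cnj (y i) * Lx i)"
    using complex_poincare[OF lap n y0] Ly by (simp add: \<kappa>_def N_def L2_set_cmod_power2)
  also have "(\<Sum>i<n. cnj (y i) * Lx i) = (\<Sum>i<n. cnj (y i) * (b i - f i * x i))"
  proof (intro sum.cong refl)
    fix i assume "i \<in> {..<n}"
    then show "cnj (y i) * Lx i = cnj (y i) * (b i - f i * x i)"
      using eq[of i] by (simp add: Lx_def eq_diff_eq add.commute)
  qed
  also have "Re \<dots> \<le> cmod \<dots>" by (rule complex_Re_le_cmod)
  also have "\<dots> \<le> N y * N (\<lambda>i. b i - f i * x i)"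
    unfolding N_def by (rule L2_set_cmod_cauchy_schwarz)
  also have "\<dots> \<le> N y * (N b + C * N x)"
  proof (rule mult_left_mono[OF _ Nnn])
    have "N (\<lambda>i. b i - f i * x i) \<le> N b + N (\<lambda>i. - (f i * x i))"
      using L2_set_cmod_triangle[of b "\<lambda>i. - (f i * x i)" "{..<n}"] by (simp add: N_def)
    also have "N (\<lambda>i. - (f i * x i)) = N (\<lambda>i. f i * x i)" by (simp add: N_def)
    also have "\<dots> \<le> C * N x" unfolding N_def by (rule L2_set_cmod_mult_le) (use C in auto)
    finally show "N (\<lambda>i. b i - f i * x i) \<le> N b + C * N x" by simp
  qed
  finally have "N y * (\<kappa> * N y) \<le> N y * (N b + C * N x)" by (simp add: power2_eq_square mult_ac)
  \<comment> \<open>For \<open>N y = 0\<close> the right side is nonnegative; otherwise the factor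
    \<open>N y\<close> cancels.\<close>
  then have "\<kappa> * N y \<le> N b + C * N x"
    using Nnn[of y] Nnn[of b] Nnn[of x] C(1) by (cases "N y = 0") auto
  then have Ny: "N y \<le> (N b + C * N x) / \<kappa>" using lpos by (simp add: field_simps)

  have "(\<Sum>i<n. f i * x i) + (\<Sum>i<n. Lx i) = (\<Sum>i<n. b i)"
    unfolding sum.distrib[symmetric] by (intro sum.cong refl) (use eq in \<open>simp add: Lx_def\<close>)
  moreover have "(\<Sum>i<n. Lx i) = 0" unfolding Lx_def by (rule laplacian_sum_eq_0[OF lap])
  moreover have "(\<Sum>i<n. f i * x i) = \<alpha> * (\<Sum>i<n. f i) + (\<Sum>i<n. f i * y i)"
    by (simp add: x algebra_simps sum.distrib sum_distrib_left)
  moreover have "(\<Sum>i<n. f i) = of_nat n * m" using m(1) n by simp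
  ultimately have al: "of_nat n * m * \<alpha> = (\<Sum>i<n. b i) - (\<Sum>i<n. f i * y i)"
    by (simp add: algebra_simps)
  \<comment> \<open>\<open>\<beta>\<close> is the rank-one main term and \<open>\<gamma>\<close> the
    correction to the mean of \<open>x\<close> caused by \<open>y\<close>.\<close>
  define \<beta> where "\<beta> = inverse m / of_nat n * (\<Sum>i<n. b i)"
  define \<gamma> where "\<gamma> = inverse m / of_nat n * (\<Sum>i<n. f i * y i)"
  have n0: "(of_nat n :: complex) \<noteq> 0" using n by simp
  have "\<alpha> = inverse m / of_nat n * (of_nat n * m * \<alpha>)" using n0 m(2) by simp
  then have al2: "\<alpha> = \<beta> - \<gamma>" unfolding al by (simp add: \<beta>_def \<gamma>_def right_diff_distrib)
  have const: "N (\<lambda>_. inverse m / of_nat n * (\<Sum>i<n. u i)) \<le> D * N u" for u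
    using L2_set_cmod_mean_le[of n "inverse m" u] mult_right_mono[OF m(3) Nnn[of u]] n
    unfolding N_def by simp
  have Fy: "N (\<lambda>i. f i * y i) \<le> C * N y" unfolding N_def by (rule L2_set_cmod_mult_le) (use C in auto)
  have "N (\<lambda>_. \<gamma>) \<le> D * N (\<lambda>i. f i * y i)" unfolding \<gamma>_def by (rule const)
  also have "\<dots> \<le> D * (C * N y)" by (rule mult_left_mono[OF Fy D])
  finally have gam: "N (\<lambda>_. \<gamma>) \<le> C * D * N y" by (simp add: mult_ac)
  have bet: "N (\<lambda>_. \<beta>) \<le> D * N b" unfolding \<beta>_def by (rule const)
  have "N (\<lambda>i. x i - \<beta>) \<le> N y + N (\<lambda>_. - \<gamma>)"
    using L2_set_cmod_triangle[of y "\<lambda>_. - \<gamma>" "{..<n}"] by (simp add: N_def x al2)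
  also have "N (\<lambda>_. - \<gamma>) = N (\<lambda>_. \<gamma>)" by (simp add: N_def)
  finally have "N (\<lambda>i. x i - \<beta>) \<le> (1 + C * D) * N y" using gam by (simp add: algebra_simps)
  also have "\<dots> \<le> (1 + C * D) * ((N b + C * N x) / \<kappa>)"
    using Ny C D by (intro mult_left_mono) auto
  finally have main: "N (\<lambda>i. x i - \<beta>) \<le> (1 + C * D) * (N b + C * N x) / \<kappa>" by simp
  then show "N (\<lambda>i. x i - inverse m / of_nat n * (\<Sum>i<n. b i)) \<le> (1 + C * D) * (N b + C * N x) / lambda2 A"
    by (simp add: \<beta>_def \<kappa>_def)
  have "N x \<le> N (\<lambda>i. x i - \<beta>) + N (\<lambda>_. \<beta>)"
    using L2_set_cmod_triangle[of "\<lambda>i. x i - \<beta>" "\<lambda>_. \<beta>" "{..<n}"] by (simp add: N_def)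
  with main bet have "N x \<le> D * N b + (1 + C * D) * (N b + C * N x) / \<kappa>" by linarith
  also have "\<dots> = (D + (1 + C * D) / \<kappa>) * N b + (C * (1 + C * D) / \<kappa>) * N x"
    by (simp add: add_divide_distrib distrib_left distrib_right mult_ac)
  \<comment> \<open>The lower bound on \<open>lambda2 A\<close> is chosen so that \<open>N x\<close>
    comes back with a factor of at most 1/2 and can be absorbed on the left.\<close>
  also have "\<dots> \<le> (D + (1 + C * D) / \<kappa>) * N b + 1 / 2 * N x"
    using lam(2) lpos Nnn by (intro add_left_mono mult_right_mono) (auto simp: \<kappa>_def field_simps)
  finally have "N x \<le> 2 * ((D + (1 + C * D) / \<kappa>) * N b)" by linarith
  then show "N x \<le> 2 * (D + (1 + C * D) / lambda2 A) * N b" by (simp only: \<kappa>_def mult.assoc)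
qed

section \<open>From the linear system to matrices and the spectral norm\<close>

lemma mult_mat_vec_nth:
  assumes "M \<in> carrier_mat n n" "v \<in> carrier_vec n" "i < n"
  shows "(M *\<^sub>v v) $ i = (\<Sum>j<n. M $$ (i,j) * v $ j)"
  using assms by (simp add: scalar_prod_def lessThan_atLeast0)

text \<open>A unit vector exists because \<open>n > 0\<close>, so the supremum in
  \<open>spec_norm\<close> runs over a nonempty set and is bounded by any upper bound.\<close>

lemma spec_norm_leI:
  assumes M: "M \<in> carrier_mat n n" and n: "n > 0"
    and le: "\<And>v. v \<in> carrier_vec n \<Longrightarrow> L2_set (\<lambda>i. cmod (v $ i)) {..<n} = 1
      \<Longrightarrow> L2_set (\<lambda>i. cmod ((M *\<^sub>v v) $ i)) {..<n} \<le> B"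
  shows "spec_norm M \<le> B"
proof -
  have dim: "dim_row M = n" "dim_col M = n" using M by auto
  have "(\<Sum>i<n. (cmod (unit_vec n 0 $ i))\<^sup>2) = (\<Sum>i<n. if i = 0 then 1 else (0::real))"
    by (intro sum.cong refl) simp
  then have "(\<Sum>i<n. (cmod (unit_vec n 0 $ i))\<^sup>2) = 1" using n by simp
  then have "\<exists>v. v \<in> carrier_vec n \<and> (\<Sum>i<n. (cmod (v $ i))\<^sup>2) = 1"
    by (intro exI[of _ "unit_vec n 0"]) simp
  then show ?thesis unfolding spec_norm_def dim
    by (intro cSup_least) (use le in \<open>auto simp: L2_set_def\<close>)
qed

locale high_gain_network =
  fixes n :: nat and A :: "real mat" and f g :: "nat \<Rightarrow> complex" and C D :: real and m :: complex
  assumes lap: "graph_laplacian n A" and n: "n \<ge> 2"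
    and C: "C \<ge> 0" "\<And>i. i < n \<Longrightarrow> cmod (f i) \<le> C"
    and m: "m = (\<Sum>i<n. f i) / of_nat n" "m \<noteq> 0" "cmod (inverse m) \<le> D"
    and lam: "lambda2 A > 0" "2 * C * (1 + C * D) \<le> lambda2 A"
    and fg: "\<And>i. i < n \<Longrightarrow> f i * g i = 1"
begin

abbreviation "G \<equiv> mat_diag n g"
abbreviation "M \<equiv> 1\<^sub>m n + G * map_mat complex_of_real A"

lemma A_carrier: "A \<in> carrier_mat n n"
  using lap by (simp add: graph_laplacian_def)

lemma GA_carrier: "G * map_mat complex_of_real A \<in> carrier_mat n n"
  by (rule mult_carrier_mat[OF mat_diag_dim]) (simp add: A_carrier)

lemma M_carrier: "M \<in> carrier_mat n n"
  by (rule add_carrier_mat[OF GA_carrier])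

lemma G_mult_vec:
  assumes "v \<in> carrier_vec n" "i < n"
  shows "(G *\<^sub>v v) $ i = g i * v $ i"
proof -
  have "(G *\<^sub>v v) $ i = (\<Sum>j<n. if j = i then g i * v $ i else 0)"
    unfolding mult_mat_vec_nth[OF mat_diag_dim assms]
    by (intro sum.cong refl) (use assms in \<open>auto simp: mat_diag_def\<close>)
  then show ?thesis using assms by simp
qed

text \<open>Multiplying row \<open>i\<close> by \<open>f i\<close> cancels \<open>g i\<close> and
  turns \<open>I + G L\<close> into \<open>F + L\<close>, the form treated by the system
  estimate.\<close>

lemma M_mult_vec:
  assumes x: "x \<in> carrier_vec n" and i: "i < n"
  shows "f i * (M *\<^sub>v x) $ i = f i * x $ i + (\<Sum>j<n. of_real (A $$ (i,j)) * x $ j)"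
proof -
  have Lc: "map_mat complex_of_real A \<in> carrier_mat n n" using A_carrier by simp
  have "M *\<^sub>v x = x + G *\<^sub>v (map_mat complex_of_real A *\<^sub>v x)"
    unfolding add_mult_distrib_mat_vec[OF one_carrier_mat GA_carrier x]
      assoc_mult_mat_vec[OF mat_diag_dim Lc x] using x by simp
  then have "(M *\<^sub>v x) $ i = x $ i + g i * (map_mat complex_of_real A *\<^sub>v x) $ i"
    using G_mult_vec[of "map_mat complex_of_real A *\<^sub>v x" i] Lc x i
    by (simp add: carrier_matD(1)[OF mat_diag_dim])
  also have "(map_mat complex_of_real A *\<^sub>v x) $ i = (\<Sum>j<n. of_real (A $$ (i,j)) * x $ j)"
    unfolding mult_mat_vec_nth[OF Lc x i] using A_carrier i by (intro sum.cong refl) auto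
  finally show ?thesis using fg[OF i] by (simp add: distrib_left mult.assoc[symmetric])
qed

text \<open>A kernel vector solves the system with right side 0, and the a priori bound on the
  solution then makes it vanish.\<close>

lemma det_M: "det M \<noteq> 0"
proof
  assume "det M = 0"
  then obtain x where x: "x \<in> carrier_vec n" "x \<noteq> 0\<^sub>v n" "M *\<^sub>v x = 0\<^sub>v n"
    unfolding det_0_iff_vec_prod_zero_field[OF M_carrier] by auto
  have "f i * x $ i + (\<Sum>j<n. of_real (A $$ (i,j)) * x $ j) = 0" if "i < n" for i
    using M_mult_vec[OF x(1) that] x(3) that by simp
  from laplacian_system_estimate(1)[OF lap n C m this lam]
  have "L2_set (\<lambda>i. cmod (x $ i)) {..<n} \<le> 0" by (simp add: L2_set_const)
  then have "L2_set (\<lambda>i. cmod (x $ i)) {..<n} = 0" using L2_set_nonneg by (rule antisym)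
  then have "\<forall>i<n. x $ i = 0" by (simp add: L2_set_eq_0_iff)
  then have "x = 0\<^sub>v n" using x(1) by (intro eq_vecI) auto
  with x(2) show False by simp
qed

text \<open>Nonsingularity guarantees that \<open>mat_inverse\<close> returns a value, so that
  \<open>the\<close> in \<open>mat_inv\<close> yields a genuine inverse.\<close>

lemma mat_inv_M: "mat_inv M \<in> carrier_mat n n" "M * mat_inv M = 1\<^sub>m n"
proof -
  have "M \<in> Units (ring_mat TYPE(complex) n ())"
    by (rule det_non_zero_imp_unit[OF M_carrier det_M])
  then obtain B where B: "mat_inverse M = Some B"
    using mat_inverse(1)[OF M_carrier, of "()"] by (cases "mat_inverse M") auto
  from mat_inverse(2)[OF M_carrier this]
  show "mat_inv M \<in> carrier_mat n n" "M * mat_inv M = 1\<^sub>m n" by (auto simp: mat_inv_def B)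
qed

lemma transfer_system:
  assumes v: "v \<in> carrier_vec n" and i: "i < n"
  defines "x \<equiv> (mat_inv M * G) *\<^sub>v v"
  shows "f i * x $ i + (\<Sum>j<n. of_real (A $$ (i,j)) * x $ j) = v $ i"
proof -
  have T: "mat_inv M * G \<in> carrier_mat n n" using mat_inv_M by auto
  have x: "x \<in> carrier_vec n" unfolding x_def using T v by auto
  have "M *\<^sub>v x = (M * (mat_inv M * G)) *\<^sub>v v"
    unfolding x_def using assoc_mult_mat_vec[OF M_carrier T v] by simp
  also have "M * (mat_inv M * G) = (M * mat_inv M) * G"
    using assoc_mult_mat[OF M_carrier mat_inv_M(1) mat_diag_dim] by simp
  also have "\<dots> = G" unfolding mat_inv_M(2) by (rule left_mult_one_mat[OF mat_diag_dim])
  finally have "f i * (M *\<^sub>v x) $ i = f i * (g i * v $ i)" using G_mult_vec[OF v i] by simp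
  then show ?thesis unfolding M_mult_vec[OF x i] using fg[OF i] by (simp add: mult.assoc[symmetric])
qed

text \<open>The error splits into \<open>h\<close>, the distance to the rank-one term with
  coefficient \<open>inverse m\<close>, of order \<open>1 / lambda2 A\<close>, and the cost of
  replacing \<open>inverse m\<close> by \<open>c\<close>. The free \<open>c\<close> is later the
  value of \<open>ghat\<close>.\<close>

lemma spec_norm_transfer_le:
  "spec_norm (mat_inv M * G - (c / of_nat n) \<cdot>\<^sub>m mat n n (\<lambda>_. 1))
    \<le> (1 + C * D) * (1 + C * (2 * (D + (1 + C * D) / lambda2 A))) / lambda2 A + cmod (inverse m - c)"
    (is "spec_norm (?T - ?J) \<le> ?B")
proof (rule spec_norm_leI)
  have T: "?T \<in> carrier_mat n n" using mat_inv_M by auto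
  have J: "?J \<in> carrier_mat n n" by simp
  show "?T - ?J \<in> carrier_mat n n" using T J by auto
  show "n > 0" using n by simp
  have CD: "1 + C * D \<ge> 0"
    using C(1) m(3) norm_ge_zero[of "inverse m"] by (meson add_nonneg_nonneg mult_nonneg_nonneg order_trans zero_le_one)
  fix v :: "complex vec" assume v: "v \<in> carrier_vec n" and v1: "L2_set (\<lambda>i. cmod (v $ i)) {..<n} = 1"
  define x where "x = ?T *\<^sub>v v"
  define h where "h = (\<lambda>i. x $ i - inverse m / of_nat n * (\<Sum>i<n. v $ i))"
  have eq: "f i * x $ i + (\<Sum>j<n. of_real (A $$ (i,j)) * x $ j) = v $ i" if "i < n" for i
    unfolding x_def by (rule transfer_system[OF v that])
  have est: "L2_set (\<lambda>i. cmod (x $ i)) {..<n} \<le> 2 * (D + (1 + C * D) / lambda2 A)"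
    "L2_set (\<lambda>i. cmod (h i)) {..<n} \<le> (1 + C * D) * (1 + C * L2_set (\<lambda>i. cmod (x $ i)) {..<n}) / lambda2 A"
    using laplacian_system_estimate[OF lap n C m eq lam] unfolding v1 h_def by simp_all
  have "L2_set (\<lambda>i. cmod (h i)) {..<n} \<le> (1 + C * D) * (1 + C * L2_set (\<lambda>i. cmod (x $ i)) {..<n}) / lambda2 A"
    by (rule est(2))
  also have "\<dots> \<le> (1 + C * D) * (1 + C * (2 * (D + (1 + C * D) / lambda2 A))) / lambda2 A"
    using est(1) lam(1) C(1) CD
    by (intro divide_right_mono mult_left_mono add_left_mono) auto
  finally have h: "L2_set (\<lambda>i. cmod (h i)) {..<n} \<le> (1 + C * D) * (1 + C * (2 * (D + (1 + C * D) / lambda2 A))) / lambda2 A" .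
  have "((?T - ?J) *\<^sub>v v) $ i = h i + (inverse m - c) / of_nat n * (\<Sum>i<n. v $ i)" if i: "i < n" for i
  proof -
    have "(?T - ?J) *\<^sub>v v = ?T *\<^sub>v v - ?J *\<^sub>v v" by (rule minus_mult_distrib_mat_vec[OF T J v])
    moreover have "(?J *\<^sub>v v) $ i = c / of_nat n * (\<Sum>i<n. v $ i)"
      unfolding mult_mat_vec_nth[OF J v i] using i by (simp add: sum_distrib_left)
    moreover have "dim_vec (?J *\<^sub>v v) = n" by simp
    ultimately have "((?T - ?J) *\<^sub>v v) $ i = x $ i - c / of_nat n * (\<Sum>i<n. v $ i)"
      using i by (simp add: x_def)
    then show ?thesis by (simp add: h_def diff_divide_distrib left_diff_distrib)
  qed
  then have "L2_set (\<lambda>i. cmod (((?T - ?J) *\<^sub>v v) $ i)) {..<n}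
      = L2_set (\<lambda>i. cmod (h i + (inverse m - c) / of_nat n * (\<Sum>i<n. v $ i))) {..<n}"
    by (intro L2_set_cong refl) simp
  also have "\<dots> \<le> L2_set (\<lambda>i. cmod (h i)) {..<n}
      + L2_set (\<lambda>i. cmod ((inverse m - c) / of_nat n * (\<Sum>i<n. v $ i))) {..<n}"
    by (rule L2_set_cmod_triangle)
  also have "\<dots> \<le> ?B"
    using h L2_set_cmod_mean_le[of n "inverse m - c" "\<lambda>i. v $ i"] n unfolding v1
    by (intro add_mono) auto
  finally show "L2_set (\<lambda>i. cmod (((?T - ?J) *\<^sub>v v) $ i)) {..<n} \<le> ?B" .
qed

end

section \<open>Concentration of the sample mean\<close>

text \<open>Independence means that the joint law is the product of the marginals; for the
  coordinate maps the joint law is the product measure itself.\<close>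

lemma indep_vars_PiM_component:
  assumes "\<And>i. prob_space (M i)"
  shows "prob_space.indep_vars (PiM UNIV M) M (\<lambda>i \<omega>. \<omega> i) UNIV"
proof -
  interpret prob_space "PiM UNIV M" by (rule prob_space_PiM) (rule assms)
  have "distr (PiM UNIV M) (PiM UNIV M) (\<lambda>x. \<lambda>i\<in>UNIV. x i) = PiM UNIV M"
    by (simp add: restrict_UNIV)
  moreover have "distr (PiM UNIV M) (M i) (\<lambda>\<omega>. \<omega> i) = M i" for i
    by (rule distr_PiM_component) (auto intro: assms)
  ultimately show ?thesis
    by (subst indep_vars_iff_distr_eq_PiM) (auto intro: measurable_component_singleton)
qed

text \<open>The variables \<open>h (w i)\<close> are independent with a common law on
  \<open>[-C, C]\<close>, an interval of length \<open>2 * C\<close>, which gives the denominator of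
  the exponent.\<close>

lemma Hoeffding_real_iid:
  fixes h :: "'w \<Rightarrow> real"
  assumes P: "prob_space P" and h[measurable]: "h \<in> borel_measurable P" and C: "C > 0" "\<And>w. \<bar>h w\<bar> \<le> C"
    and n: "n > 0" and eta: "\<eta> \<ge> 0"
  defines "Q \<equiv> PiM UNIV (\<lambda>_::nat. P)"
  shows "measure Q {w \<in> space Q. \<bar>(\<Sum>i<n. h (w i)) / n - integral\<^sup>L P h\<bar> \<ge> \<eta>}
    \<le> 2 * exp (- 2 * real n * \<eta>\<^sup>2 / (2 * C)\<^sup>2)"
proof -
  interpret P: prob_space P by (rule P)
  interpret Q: prob_space Q unfolding Q_def by (rule prob_space_PiM) (rule P)
  have comp[measurable]: "(\<lambda>w. w i) \<in> measurable Q P" for i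
    unfolding Q_def by (rule measurable_component_singleton) simp
  have distr_comp: "distr Q P (\<lambda>w. w i) = P" for i
    unfolding Q_def by (rule distr_PiM_component) (auto intro: P)
  have distr_h: "distr Q borel (\<lambda>w. h (w i)) = distr P borel h" for i
  proof -
    have "distr P borel h = distr (distr Q P (\<lambda>w. w i)) borel h" by (simp only: distr_comp)
    also have "\<dots> = distr Q borel (\<lambda>w. h (w i))" by (subst distr_distr) (auto simp: o_def)
    finally show ?thesis by simp
  qed
  have "Q.indep_vars (\<lambda>_. P) (\<lambda>i w. w i) {..<n}"
    by (rule Q.indep_vars_subset[where I = UNIV])
      (use indep_vars_PiM_component[of "\<lambda>_::nat. P"] P in \<open>auto simp: Q_def\<close>)
  then have ind: "Q.indep_vars (\<lambda>_. borel) (\<lambda>i w. h (w i)) {..<n}"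
    by (rule Q.indep_vars_compose2) simp
  have exp_h: "Q.expectation (\<lambda>w. h (w 0)) = integral\<^sup>L P h"
    using integral_distr[of "\<lambda>w. w 0" Q P h] by (simp add: distr_comp)
  interpret H: Hoeffding_ineq_iid Q "{..<n}" "\<lambda>i w. h (w i)" "\<lambda>w. h (w 0)" "- C" C "Q.expectation (\<lambda>w. h (w 0))"
  proof (unfold_locales, simp, rule ind)
    show "distr Q borel (\<lambda>w. h (w i)) = distr Q borel (\<lambda>w. h (w 0))" for i by (simp only: distr_h)
    show "(\<lambda>w. h (w 0)) \<in> borel_measurable Q" by simp
    show "AE x in Q. h (x 0) \<in> {- C..C}"
      by (rule AE_I2) (use C(2) in \<open>simp add: abs_le_iff minus_le_iff\<close>)
  qed simp
  show ?thesis
    using H.Hoeffding_ineq_abs_ge'[OF eta] C n by (simp add: exp_h lessThan_empty_iff)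
qed

text \<open>Real and imaginary parts are treated separately, each with threshold
  \<open>\<eta> / 2\<close>; the two real bounds add up to the factor 4.\<close>

lemma Hoeffding_complex_iid:
  fixes h :: "'w \<Rightarrow> complex"
  assumes P: "prob_space P" and h[measurable]: "h \<in> borel_measurable P" and C: "C > 0" "\<And>w. cmod (h w) \<le> C"
    and n: "n > 0" and eta: "\<eta> \<ge> 0"
  defines "Q \<equiv> PiM UNIV (\<lambda>_::nat. P)"
  shows "measure Q {w \<in> space Q. cmod ((\<Sum>i<n. h (w i)) / of_nat n - integral\<^sup>L P h) \<ge> \<eta>}
    \<le> 4 * exp (- (real n * \<eta>\<^sup>2 / (8 * C\<^sup>2)))"
    and "{w \<in> space Q. cmod ((\<Sum>i<n. h (w i)) / of_nat n - integral\<^sup>L P h) \<ge> \<eta>} \<in> sets Q"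
proof -
  interpret P: prob_space P by (rule P)
  interpret Q: prob_space Q unfolding Q_def by (rule prob_space_PiM) (rule P)
  have comp[measurable]: "(\<lambda>w. w i) \<in> measurable Q P" for i
    unfolding Q_def by (rule measurable_component_singleton) simp
  let ?D = "\<lambda>w. (\<Sum>i<n. h (w i)) / of_nat n - integral\<^sup>L P h"
  let ?R = "\<lambda>w. (\<Sum>i<n. Re (h (w i))) / n - integral\<^sup>L P (\<lambda>w. Re (h w))"
  let ?I = "\<lambda>w. (\<Sum>i<n. Im (h (w i))) / n - integral\<^sup>L P (\<lambda>w. Im (h w))"
  show "{w \<in> space Q. \<eta> \<le> cmod (?D w)} \<in> sets Q" by measurable
  have int: "integrable P h" by (rule P.integrable_const_bound[of _ C]) (use C in auto)
  have ReD: "Re (?D w) = ?R w" and ImD: "Im (?D w) = ?I w" for w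
    using int by (simp_all add: Re_divide_of_nat Im_divide_of_nat)
  have "{w \<in> space Q. \<eta> \<le> cmod (?D w)} \<subseteq> {w \<in> space Q. \<eta> / 2 \<le> \<bar>?R w\<bar>} \<union> {w \<in> space Q. \<eta> / 2 \<le> \<bar>?I w\<bar>}"
  proof
    fix w assume w: "w \<in> {w \<in> space Q. \<eta> \<le> cmod (?D w)}"
    have "\<eta> \<le> \<bar>?R w\<bar> + \<bar>?I w\<bar>" using w cmod_le[of "?D w"] unfolding ReD ImD by auto
    then have "\<eta> / 2 \<le> \<bar>?R w\<bar> \<or> \<eta> / 2 \<le> \<bar>?I w\<bar>" by linarith
    then show "w \<in> {w \<in> space Q. \<eta> / 2 \<le> \<bar>?R w\<bar>} \<union> {w \<in> space Q. \<eta> / 2 \<le> \<bar>?I w\<bar>}" using w by simp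
  qed
  then have "measure Q {w \<in> space Q. \<eta> \<le> cmod (?D w)}
      \<le> measure Q ({w \<in> space Q. \<eta> / 2 \<le> \<bar>?R w\<bar>} \<union> {w \<in> space Q. \<eta> / 2 \<le> \<bar>?I w\<bar>})"
    by (rule Q.finite_measure_mono) measurable
  also have "\<dots> \<le> measure Q {w \<in> space Q. \<eta> / 2 \<le> \<bar>?R w\<bar>} + measure Q {w \<in> space Q. \<eta> / 2 \<le> \<bar>?I w\<bar>}"
    by (rule measure_Un_le) measurable
  also have "\<dots> \<le> 2 * exp (- 2 * real n * (\<eta> / 2)\<^sup>2 / (2 * C)\<^sup>2) + 2 * exp (- 2 * real n * (\<eta> / 2)\<^sup>2 / (2 * C)\<^sup>2)"
    unfolding Q_def
  proof (rule add_mono)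
    show "measure (PiM UNIV (\<lambda>_::nat. P)) {w \<in> space (PiM UNIV (\<lambda>_::nat. P)). \<eta> / 2 \<le> \<bar>?R w\<bar>}
        \<le> 2 * exp (- 2 * real n * (\<eta> / 2)\<^sup>2 / (2 * C)\<^sup>2)"
      by (rule Hoeffding_real_iid[of P "\<lambda>w. Re (h w)" C n "\<eta> / 2"])
        (use P C n eta in \<open>auto intro: order_trans[OF abs_Re_le_cmod C(2)]\<close>)
    show "measure (PiM UNIV (\<lambda>_::nat. P)) {w \<in> space (PiM UNIV (\<lambda>_::nat. P)). \<eta> / 2 \<le> \<bar>?I w\<bar>}
        \<le> 2 * exp (- 2 * real n * (\<eta> / 2)\<^sup>2 / (2 * C)\<^sup>2)"
      by (rule Hoeffding_real_iid[of P "\<lambda>w. Im (h w)" C n "\<eta> / 2"])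
        (use P C n eta in \<open>auto intro: order_trans[OF abs_Im_le_cmod C(2)]\<close>)
  qed
  also have "\<dots> = 4 * exp (- (real n * \<eta>\<^sup>2 / (8 * C\<^sup>2)))"
    by (simp add: power_divide power_mult_distrib)
  finally show "measure Q {w \<in> space Q. \<eta> \<le> cmod (?D w)} \<le> 4 * exp (- (real n * \<eta>\<^sup>2 / (8 * C\<^sup>2)))" .
qed

text \<open>The event of the theorem involves a supremum over all of \<open>S\<close>; it is
  controlled only through a measurable superset.\<close>

lemma outer_prob_le: 
  assumes "A \<in> sets M" "E \<subseteq> A"
  shows "outer_prob M E \<le> measure M A"
  unfolding outer_prob_def using assms by (intro cInf_lower) (auto intro!: bdd_belowI[of _ 0])

text \<open>The whole space is a measurable cover of \<open>E\<close>, so the infimum is taken over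
  a nonempty set.\<close>

lemma outer_prob_nonneg:
  assumes "E \<subseteq> space M"
  shows "outer_prob M E \<ge> 0"
  unfolding outer_prob_def using assms by (intro cInf_greatest) auto

lemma poly_eq_sum_coeff_le:
  fixes p :: "'a::comm_semiring_1 poly"
  assumes "degree p \<le> N"
  shows "poly p x = (\<Sum>i\<le>N. coeff p i * x ^ i)"
  unfolding poly_altdef using assms by (intro sum.mono_neutral_left) (auto simp: coeff_eq_0)

text \<open>The degree bound \<open>N\<close> is uniform in the sample, so numerator and denominator
  are sums of fixed length with measurable coefficients.\<close>

lemma random_rational_tf_measurable:
  assumes "random_rational_tf P g"
  shows "(\<lambda>w. g s w) \<in> borel_measurable P"
proof -
  obtain num den :: "_ \<Rightarrow> real poly" and N where
    deg: "\<And>w. degree (num w) \<le> N" "\<And>w. degree (den w) \<le> N"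
    and [measurable]: "\<And>i. (\<lambda>w. coeff (num w) i) \<in> borel_measurable P"
      "\<And>i. (\<lambda>w. coeff (den w) i) \<in> borel_measurable P"
    and g: "\<And>s w. g s w = poly (map_poly complex_of_real (num w)) s
                       / poly (map_poly complex_of_real (den w)) s"
    using assms unfolding random_rational_tf_def by blast
  have eq: "poly (map_poly complex_of_real p) s = (\<Sum>i\<le>N. of_real (coeff p i) * s ^ i)" if "degree p \<le> N" for p
    using poly_eq_sum_coeff_le[of "map_poly complex_of_real p" N s] that
    by (simp add: coeff_map_poly degree_map_poly)
  show ?thesis unfolding g eq[OF deg(1)] eq[OF deg(2)] by measurable
qed

text \<open>The bound on \<open>inverse a\<close> keeps \<open>a\<close> at distance
  \<open>1 / D\<close> from 0, so \<open>b\<close> stays at distance \<open>1 / (2 * D)\<close>.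
  With \<open>a\<close> a sample mean and \<open>b\<close> the expectation, this shows that the
  expectation does not vanish.\<close>

lemma inverse_diff_le:
  fixes a b :: complex
  assumes a: "a \<noteq> 0" "cmod (inverse a) \<le> D" and D: "D > 0" and ab: "cmod (a - b) \<le> 1 / (2 * D)"
  shows "cmod (inverse a - inverse b) \<le> 2 * D\<^sup>2 * cmod (a - b)"
proof -
  have "1 \<le> D * cmod a" using mult_right_mono[OF a(2), of "cmod a"] a(1) by (simp add: norm_inverse)
  then have "1 / D \<le> cmod a" using D by (simp add: field_simps)
  moreover have "cmod a \<le> cmod (a - b) + cmod b" using norm_triangle_ineq[of "a - b" b] by simp
  moreover have "1 / D = 1 / (2 * D) + 1 / (2 * D)" by simp
  ultimately have cb: "1 / (2 * D) \<le> cmod b" using ab by linarith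
  moreover have "1 / (2 * D) > 0" using D by simp
  ultimately have b: "b \<noteq> 0" by auto
  have ib: "cmod (inverse b) \<le> 2 * D"
    using le_imp_inverse_le[OF cb] D by (simp add: norm_inverse)
  have "cmod (inverse a - inverse b) = cmod (inverse a) * cmod (a - b) * cmod (inverse b)"
    using a b by (simp add: inverse_diff_inverse norm_mult norm_minus_commute)
  also have "\<dots> \<le> D * cmod (a - b) * (2 * D)"
    using a ib D by (intro mult_mono) auto
  finally show ?thesis by (simp add: power2_eq_square mult_ac)
qed

text \<open>Passing from \<open>s\<close> to \<open>t\<close> costs \<open>c\<close> once for the
  sample mean and once for the expectation.\<close>

lemma Lipschitz_mean_error:
  fixes f :: "complex \<Rightarrow> 'w \<Rightarrow> complex"
  assumes P: "prob_space P" and int: "integrable P (f s)" "integrable P (f t)"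
    and lip: "\<And>w. cmod (f s w - f t w) \<le> c" and n: "n > 0"
  shows "cmod ((\<Sum>i<n. f s (w i)) / of_nat n - integral\<^sup>L P (f s))
    \<le> 2 * c + cmod ((\<Sum>i<n. f t (w i)) / of_nat n - integral\<^sup>L P (f t))"
proof -
  interpret P: prob_space P by (rule P)
  define m where "m = (\<lambda>s. (\<Sum>i<n. f s (w i)) / of_nat n)"
  have "m s - m t = (\<Sum>i<n. f s (w i) - f t (w i)) / of_nat n"
    by (simp add: m_def sum_subtractf diff_divide_distrib)
  also have "cmod \<dots> \<le> (\<Sum>i<n. c) / n"
    unfolding norm_divide norm_of_nat by (intro divide_right_mono sum_norm_le lip) auto
  finally have 1: "cmod (m s - m t) \<le> c" using n by simp
  have "cmod (integral\<^sup>L P (f t) - integral\<^sup>L P (f s)) = cmod (integral\<^sup>L P (\<lambda>w. f s w - f t w))"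
    using int by (simp add: norm_minus_commute)
  also have "\<dots> \<le> integral\<^sup>L P (\<lambda>w. cmod (f s w - f t w))" by (rule integral_norm_bound)
  also have "\<dots> \<le> c" using int lip by (intro P.integral_le_const) auto
  finally have 2: "cmod (integral\<^sup>L P (f t) - integral\<^sup>L P (f s)) \<le> c" .
  have "m s - integral\<^sup>L P (f s) = (m s - m t) + (m t - integral\<^sup>L P (f t)) + (integral\<^sup>L P (f t) - integral\<^sup>L P (f s))"
    by simp
  also have "cmod \<dots> \<le> cmod (m s - m t) + cmod (m t - integral\<^sup>L P (f t))
      + cmod (integral\<^sup>L P (f t) - integral\<^sup>L P (f s))"
    by (meson add_right_mono norm_triangle_ineq order_trans)
  finally show ?thesis using 1 2 by (simp add: m_def)
qed

lemma Hoeffding_finite_union: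
  fixes f :: "'s \<Rightarrow> 'w \<Rightarrow> complex"
  assumes P: "prob_space P" and k: "finite k" and f: "\<And>t. t \<in> k \<Longrightarrow> f t \<in> borel_measurable P"
    and C: "C > 0" "\<And>t w. t \<in> k \<Longrightarrow> cmod (f t w) \<le> C" and n: "n > 0" and eta: "\<eta> \<ge> 0"
  defines "Q \<equiv> PiM UNIV (\<lambda>_::nat. P)"
  defines "B \<equiv> \<Union>t\<in>k. {w \<in> space Q. cmod ((\<Sum>i<n. f t (w i)) / of_nat n - integral\<^sup>L P (f t)) \<ge> \<eta>}"
  shows "B \<in> sets Q" "measure Q B \<le> card k * (4 * exp (- (real n * \<eta>\<^sup>2 / (8 * C\<^sup>2))))"
proof -
  interpret Q: prob_space Q unfolding Q_def by (rule prob_space_PiM) (rule P)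
  note H = Hoeffding_complex_iid[OF P f C(1) C(2) n eta, folded Q_def]
  show "B \<in> sets Q" unfolding B_def using k H(2) by (intro sets.finite_UN) auto
  have "measure Q B \<le> (\<Sum>t\<in>k. measure Q {w \<in> space Q. cmod ((\<Sum>i<n. f t (w i)) / of_nat n - integral\<^sup>L P (f t)) \<ge> \<eta>})"
    unfolding B_def using H(2) by (intro Q.finite_measure_subadditive_finite k) auto
  also have "\<dots> \<le> (\<Sum>t\<in>k. 4 * exp (- (real n * \<eta>\<^sup>2 / (8 * C\<^sup>2))))"
    by (intro sum_mono H(1))
  finally show "measure Q B \<le> card k * (4 * exp (- (real n * \<eta>\<^sup>2 / (8 * C\<^sup>2))))" by simp
qed

lemma exp_bound_tendsto_0:
  assumes "a > 0"
  shows "(\<lambda>n. c * (4 * exp (- (real n * a)))) \<longlonglongrightarrow> 0"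
proof -
  have "(\<lambda>n. exp (- a) ^ n) \<longlonglongrightarrow> 0"
    by (rule LIMSEQ_realpow_zero) (use assms in auto)
  then have "(\<lambda>n. c * (4 * (exp (- a) ^ n))) \<longlonglongrightarrow> c * (4 * 0)"
    by (intro tendsto_mult tendsto_const)
  then show ?thesis by (simp add: exp_of_nat_mult[symmetric])
qed

section \<open>Convergence in probability\<close>

text \<open>Since \<open>inverse 0 = 0\<close>, the bounds \<open>h1\<close> and \<open>h2\<close>
  come with explicit nonvanishing. The supremum lives in \<open>ereal\<close>, where it exists
  without a boundedness proof; over an empty \<open>S\<close> it is minus infinity and the event is
  empty.\<close>

theorem theorem7:
  fixes P :: "(real ^ 'd) measure"
    and g :: "complex \<Rightarrow> real ^ 'd \<Rightarrow> complex"
    and L :: "nat \<Rightarrow> real mat"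
    and S :: "complex set"
    and \<epsilon> :: real
  assumes P: "prob_space P" "sets P = sets borel"
    and rtf: "random_rational_tf P g"
    and lap: "\<And>n. graph_laplacian n (L n)"
    and lam: "filterlim (\<lambda>n. lambda2 (L n)) at_top sequentially"
    and S: "compact S"
    and h1: "\<exists>C. \<forall>s\<in>S. \<forall>w. g s w \<noteq> 0 \<and> cmod (inverse (g s w)) \<le> C"
    and h2: "\<exists>C. \<forall>n\<ge>1. \<forall>s\<in>S. \<forall>w :: nat \<Rightarrow> real ^ 'd.
               (\<Sum>i<n. inverse (g s (w i))) \<noteq> 0 \<and> cmod (gbar g n s w) \<le> C"
    and h3: "\<exists>Lc>0. \<forall>w. \<forall>s1\<in>S. \<forall>s2\<in>S.
               cmod (inverse (g s1 w) - inverse (g s2 w)) \<le> Lc * cmod (s1 - s2)"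
    and h4: "uniformly_continuous_on S (ghat P g)"
    and eps: "\<epsilon> > 0"
  shows "(\<lambda>n. outer_prob (Pi\<^sub>M UNIV (\<lambda>_::nat. P))
            {w \<in> space (Pi\<^sub>M UNIV (\<lambda>_::nat. P)).
               (SUP s\<in>S. ereal (spec_norm (Tn g (L n) n s w
                   - (ghat P g s / of_nat n) \<cdot>\<^sub>m mat n n (\<lambda>_. 1))))
               \<ge> ereal \<epsilon>}) \<longlonglongrightarrow> 0"
proof -
  interpret P: prob_space P by (rule P(1))
  define Q where "Q = Pi\<^sub>M UNIV (\<lambda>_::nat. P)"
  define f where "f = (\<lambda>s w. inverse (g s w))"
  define mean where "mean = (\<lambda>n s w. (\<Sum>i<n. f s (w i)) / of_nat n)"
  define \<mu> where "\<mu> = (\<lambda>s. integral\<^sup>L P (f s))"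
  have ghat: "ghat P g s = inverse (\<mu> s)" for s by (simp add: ghat_def \<mu>_def f_def)
  obtain C0 where C0: "\<And>s w. s \<in> S \<Longrightarrow> g s w \<noteq> 0" "\<And>s w. s \<in> S \<Longrightarrow> cmod (f s w) \<le> C0"
    using h1 unfolding f_def by blast
  \<comment> \<open>The maximum with 1 makes the bound positive, as Hoeffding's inequality requires;
    \<open>D\<close> is treated likewise because it is divided by.\<close>
  define C where "C = max C0 1"
  have C: "C > 0" "\<And>s w. s \<in> S \<Longrightarrow> cmod (f s w) \<le> C"
    using C0(2) by (auto simp: C_def le_max_iff_disj)
  obtain D0 where D0: "\<And>(n::nat) s w. n \<ge> 1 \<Longrightarrow> s \<in> S \<Longrightarrow> (\<Sum>i<n. f s (w i)) \<noteq> 0"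
    "\<And>n s w. n \<ge> 1 \<Longrightarrow> s \<in> S \<Longrightarrow> cmod (gbar g n s w) \<le> D0"
    using h2 unfolding f_def by blast
  define D where "D = max D0 1"
  have D: "D > 0" "\<And>n s w. n \<ge> 1 \<Longrightarrow> s \<in> S \<Longrightarrow> cmod (inverse (mean n s w)) \<le> D"
    using D0(2) by (auto simp: D_def gbar_def mean_def f_def le_max_iff_disj)
  have mean0: "mean n s w \<noteq> 0" if "n \<ge> 1" "s \<in> S" for n s w
    using D0(1)[OF that] that by (simp add: mean_def)
  obtain Lc where Lc: "Lc > 0" "\<And>w s t. s \<in> S \<Longrightarrow> t \<in> S \<Longrightarrow> cmod (f s w - f t w) \<le> Lc * cmod (s - t)"
    using h3 unfolding f_def by blast
  have meas: "f s \<in> borel_measurable P" for s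
    unfolding f_def by (intro borel_measurable_inverse random_rational_tf_measurable[OF rtf])
  have int: "integrable P (f s)" if "s \<in> S" for s
    by (rule P.integrable_const_bound[of _ C]) (use C(2)[OF that] meas in auto)

  \<comment> \<open>The admissible error of the mean: the first entry licenses
    \<open>inverse_diff_le\<close>, the second makes the resulting error of the inverses at most
    \<open>\<epsilon> / 4\<close>.\<close>
  define \<tau> where "\<tau> = min (1 / (2 * D)) (\<epsilon> / (8 * D\<^sup>2))"
  have tau: "\<tau> > 0" "\<tau> \<le> 1 / (2 * D)" "2 * D\<^sup>2 * \<tau> \<le> \<epsilon> / 4"
  proof -
    show "\<tau> > 0" "\<tau> \<le> 1 / (2 * D)" using D(1) eps by (auto simp: \<tau>_def)
    have "2 * D\<^sup>2 * \<tau> \<le> 2 * D\<^sup>2 * (\<epsilon> / (8 * D\<^sup>2))" by (intro mult_left_mono) (auto simp: \<tau>_def)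
    also have "\<dots> = \<epsilon> / 4" using D(1) by simp
    finally show "2 * D\<^sup>2 * \<tau> \<le> \<epsilon> / 4" .
  qed
  \<comment> \<open>With this mesh, moving to a net point changes \<open>f\<close> by at most
    \<open>\<tau> / 4\<close>, hence the mean error by at most \<open>\<tau> / 2\<close>; the other
    half of \<open>\<tau>\<close> is left for the error on the net.\<close>
  define \<delta> where "\<delta> = \<tau> / (4 * Lc)"
  have \<delta>: "\<delta> > 0" using tau(1) Lc(1) by (simp add: \<delta>_def)
  obtain k where k: "finite k" "k \<subseteq> S" "S \<subseteq> (\<Union>t\<in>k. ball t \<delta>)"
    using seq_compact_imp_totally_bounded[OF compact_imp_seq_compact[OF S], rule_format, OF \<delta>]
    by (elim exE conjE) (rule that)
  \<comment> \<open>The measurable exceptional event: it tests only the finitely many net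
    points.\<close>
  define bad where "bad = (\<lambda>n. \<Union>t\<in>k. {w \<in> space Q. cmod (mean n t w - \<mu> t) \<ge> \<tau> / 2})"
  have bad: "bad n \<in> sets Q" "measure Q (bad n) \<le> card k * (4 * exp (- (real n * ((\<tau> / 2)\<^sup>2 / (8 * C\<^sup>2)))))"
    if n: "n \<ge> 1" for n
  proof -
    have *: "cmod (f t w) \<le> C" if "t \<in> k" for t w using C(2) k(2) that by blast
    have n0: "n > 0" and tau0: "\<tau> / 2 \<ge> 0" using n tau(1) by simp_all
    note H = Hoeffding_finite_union[OF P(1) k(1) meas C(1) * n0 tau0, folded Q_def]
    show "bad n \<in> sets Q" unfolding bad_def mean_def \<mu>_def by (rule H(1))
    show "measure Q (bad n) \<le> card k * (4 * exp (- (real n * ((\<tau> / 2)\<^sup>2 / (8 * C\<^sup>2)))))"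
      using H(2) unfolding bad_def mean_def \<mu>_def by simp
  qed
  have good: "cmod (mean n s w - \<mu> s) \<le> \<tau>"
    if n: "n \<ge> 1" and s: "s \<in> S" and w: "w \<in> space Q" "w \<notin> bad n" for n s w
  proof -
    obtain t where t: "t \<in> k" "dist t s < \<delta>" using k(3) s by auto
    have "cmod (f s w - f t w) \<le> \<tau> / 4" for w
    proof -
      have "cmod (f s w - f t w) \<le> Lc * cmod (s - t)" using Lc(2) s t(1) k(2) by auto
      also have "\<dots> \<le> Lc * \<delta>"
        using t(2) Lc(1) by (intro mult_left_mono) (auto simp: dist_norm norm_minus_commute)
      also have "\<dots> = \<tau> / 4" using Lc(1) by (simp add: \<delta>_def)
      finally show ?thesis .
    qed
    from Lipschitz_mean_error[OF P(1) int[OF s] int this, of n w]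
    have "cmod (mean n s w - \<mu> s) \<le> 2 * (\<tau> / 4) + cmod (mean n t w - \<mu> t)"
      using t(1) k(2) n by (auto simp: mean_def \<mu>_def)
    moreover have "cmod (mean n t w - \<mu> t) < \<tau> / 2" using w t(1) by (auto simp: bad_def not_le)
    ultimately show ?thesis by simp
  qed

  \<comment> \<open>This is the numerator of the spectral norm bound with the inner
    \<open>lambda2\<close> replaced by 1.\<close>
  define K where "K = (1 + C * D) * (1 + C * (2 * (D + (1 + C * D))))"
  have K: "K > 0" unfolding K_def using C(1) D(1) by (intro mult_pos_pos add_pos_pos) auto
  \<comment> \<open>The three entries justify that replacement, meet the threshold of the system
    estimate, and make the gap error at most \<open>\<epsilon> / 4\<close>.\<close>
  define Z where "Z = Max {1, 2 * C * (1 + C * D), 4 * K / \<epsilon>}"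
  have ev: "eventually (\<lambda>n. n \<ge> 2 \<and> lambda2 (L n) \<ge> Z) sequentially"
    using lam eventually_ge_at_top[of 2] unfolding filterlim_at_top by (simp add: eventually_conj)
  have sub: "{w \<in> space Q. (SUP s\<in>S. ereal (spec_norm (Tn g (L n) n s w
      - (ghat P g s / of_nat n) \<cdot>\<^sub>m mat n n (\<lambda>_. 1)))) \<ge> ereal \<epsilon>} \<subseteq> bad n"
    if n: "n \<ge> 2" "lambda2 (L n) \<ge> Z" for n
  proof (rule subsetI, rule ccontr)
    fix w
    assume w: "w \<in> {w \<in> space Q. (SUP s\<in>S. ereal (spec_norm (Tn g (L n) n s w
      - (ghat P g s / of_nat n) \<cdot>\<^sub>m mat n n (\<lambda>_. 1)))) \<ge> ereal \<epsilon>}" and nb: "w \<notin> bad n"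
    have l: "lambda2 (L n) \<ge> 1" "2 * C * (1 + C * D) \<le> lambda2 (L n)" "4 * K / \<epsilon> \<le> lambda2 (L n)"
      using n(2) by (auto simp: Z_def)
    \<comment> \<open>The two errors of \<open>\<epsilon> / 4\<close> sum to
      \<open>\<epsilon> / 2\<close>, uniformly in \<open>s\<close>; the slack keeps the supremum
      strictly below \<open>\<epsilon>\<close>.\<close>
    have "spec_norm (Tn g (L n) n s w - (ghat P g s / of_nat n) \<cdot>\<^sub>m mat n n (\<lambda>_. 1)) \<le> \<epsilon> / 2"
      if s: "s \<in> S" for s
    proof -
      interpret N: high_gain_network n "L n" "\<lambda>i. f s (w i)" "\<lambda>i. g s (w i)" C D "mean n s w"
        using n(1) s C D mean0 lap l C0(1) by unfold_locales (auto simp: mean_def f_def)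
      have d: "cmod (mean n s w - \<mu> s) \<le> \<tau>" using good[of n s w] n(1) s w nb by auto
      have "cmod (inverse (mean n s w) - inverse (\<mu> s)) \<le> 2 * D\<^sup>2 * cmod (mean n s w - \<mu> s)"
        using d tau(2) n(1) by (intro inverse_diff_le mean0 D s) auto
      also have "\<dots> \<le> 2 * D\<^sup>2 * \<tau>" using d by (intro mult_left_mono) auto
      also have "\<dots> \<le> \<epsilon> / 4" by (rule tau(3))
      finally have 1: "cmod (inverse (mean n s w) - inverse (\<mu> s)) \<le> \<epsilon> / 4" .
      have "(1 + C * D) / lambda2 (L n) \<le> 1 + C * D"
        using divide_left_mono[of 1 "lambda2 (L n)" "1 + C * D"] l(1) C(1) D(1) by simp
      then have "(1 + C * D) * (1 + C * (2 * (D + (1 + C * D) / lambda2 (L n)))) / lambda2 (L n) \<le> K / lambda2 (L n)"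
        unfolding K_def using l(1) C(1) D(1)
        by (intro divide_right_mono mult_left_mono add_left_mono) auto
      also have "\<dots> \<le> \<epsilon> / 4" using l(1,3) eps by (simp add: field_simps)
      finally show ?thesis
        unfolding Tn_def Let_def ghat using N.spec_norm_transfer_le[of "inverse (\<mu> s)"] 1 by linarith
    qed
    then have "(SUP s\<in>S. ereal (spec_norm (Tn g (L n) n s w
      - (ghat P g s / of_nat n) \<cdot>\<^sub>m mat n n (\<lambda>_. 1)))) \<le> ereal (\<epsilon> / 2)"
      by (intro SUP_least) simp
    moreover have "ereal (\<epsilon> / 2) < ereal \<epsilon>" using eps by simp
    moreover have "ereal \<epsilon> \<le> (SUP s\<in>S. ereal (spec_norm (Tn g (L n) n s w
      - (ghat P g s / of_nat n) \<cdot>\<^sub>m mat n n (\<lambda>_. 1))))" using w by simp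
    ultimately show False by (meson leD order_trans)
  qed
  show ?thesis unfolding Q_def[symmetric]
  proof (rule tendsto_sandwich[OF _ _ tendsto_const exp_bound_tendsto_0])
    show "(\<tau> / 2)\<^sup>2 / (8 * C\<^sup>2) > 0" using tau(1) C(1) by simp
    show "\<forall>\<^sub>F n in sequentially. 0 \<le> outer_prob Q {w \<in> space Q. (SUP s\<in>S. ereal (spec_norm (Tn g (L n) n s w
      - (ghat P g s / of_nat n) \<cdot>\<^sub>m mat n n (\<lambda>_. 1)))) \<ge> ereal \<epsilon>}"
      by (intro always_eventually allI outer_prob_nonneg) auto
    show "\<forall>\<^sub>F n in sequentially. outer_prob Q {w \<in> space Q. (SUP s\<in>S. ereal (spec_norm (Tn g (L n) n s w
      - (ghat P g s / of_nat n) \<cdot>\<^sub>m mat n n (\<lambda>_. 1)))) \<ge> ereal \<epsilon>}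
      \<le> card k * (4 * exp (- (real n * ((\<tau> / 2)\<^sup>2 / (8 * C\<^sup>2)))))"
      using ev
    proof eventually_elim
      case (elim n)
      then have "n \<ge> 1" by simp
      have "outer_prob Q {w \<in> space Q. (SUP s\<in>S. ereal (spec_norm (Tn g (L n) n s w
          - (ghat P g s / of_nat n) \<cdot>\<^sub>m mat n n (\<lambda>_. 1)))) \<ge> ereal \<epsilon>} \<le> measure Q (bad n)"
        using elim by (intro outer_prob_le bad(1) sub) auto
      also note bad(2)[OF \<open>n \<ge> 1\<close>]
      finally show ?case .
    qed
  qed
qed

end
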